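(* Let $\varepsilon\ge0$ and $\delta\in[0,1]$, and let $\mathsf{K}:\mathcal{D}\to\mathcal{P}(\mathcal{W})$ be a Markov kernel, where $\mathcal{D}$ and $\mathcal{W}$ are subsets of Euclidean spaces. Then $\mathsf{K}$ is $(\varepsilon,\delta)$-LDP if and only if $\eta_{e^\varepsilon}(\mathsf{K})\le\delta$, i.e., if and only if $$\mathsf{E}_{e^\varepsilon}(\mu\mathsf{K}\|\nu\mathsf{K})\le\delta\,\mathsf{E}_{e^\varepsilon}(\mu\|\nu)\qquad\text{for all }\mu,\nu\in\mathcal{P}(\mathcal{D}).$$
   Context: $\mathcal{P}(\cdot)$ denotes the set of probability measures on a set. A Markov kernel (mechanism) $\mathsf{K}:\mathcal{D}\to\mathcal{P}(\mathcal{W})$ is $(\varepsilon,\delta)$-LDP (locally differentially private) if $\sup_{x_1,x_2\in\mathcal{D}}\sup_{A\subset\mathcal{W}}[\mathsf{K}(A|x_1)-e^\varepsilon\mathsf{K}(A|x_2)]\le\delta$, with $A$ ranging over measurable sets. For $\gamma\ge1$ and probability measures $\mu,\nu$ on the same space, $\mathsf{E}_\gamma(\mu\|\nu)=\sup_{A}[\mu(A)-\gamma\nu(A)]$ over measurable $A$. For $\mu\in\mathcal{P}(\mathcal{D})$, $\mu\mathsf{K}=\int\mu(dx)\,\mathsf{K}(\cdot|x)$. The contraction coefficient is $\eta_\gamma(\mathsf{K})=\sup\left\{\frac{\mathsf{E}_\gamma(\mu\mathsf{K}\|\nu\mathsf{K})}{\mathsf{E}_\gamma(\mu\|\nu)}:\mu,\nu\in\mathcal{P}(\mathcal{D}),\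 \mathsf{E}_\gamma(\mu\|\nu)\ne0\right\}$ (the supremum of the empty set being $0$). *)

theory Defs
  imports "HOL-Probability.Probability"
begin

text \<open>
  A Markov kernel from M to N is a map in \<open>M \<rightarrow>\<^sub>M prob_algebra N\<close>, the probability measures on M are
  the elements of \<open>space (prob_algebra M)\<close>, and the output distribution of \<open>\<mu>\<close> under K is the Giry
  bind \<open>\<mu> \<bind> K\<close>, whose value at A is the integral of \<open>K x A\<close> against \<open>\<mu>\<close>.
\<close>

text \<open>
  The supremum is taken in the extended reals, so that it also has a value when the input space is empty.
\<close>

definition LDP :: "real \<Rightarrow> real \<Rightarrow> 'a measure \<Rightarrow> 'b measure \<Rightarrow> ('a \<Rightarrow> 'b measure) \<Rightarrow> bool" where
  "LDP \<epsilon> \<delta> M N K \<longleftrightarrow>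
    (SUP x1\<in>space M. SUP x2\<in>space M. SUP A\<in>sets N.
       ereal (measure (K x1) A - exp \<epsilon> * measure (K x2) A)) \<le> ereal \<delta>"

text \<open>
  For probability measures \<open>\<mu>\<close>, \<open>\<nu>\<close> on the same measurable space and \<open>\<gamma> \<ge> 0\<close>, the set below contains 0
  (take A empty) and is bounded above by 1, so its real supremum is the actual least upper bound.
\<close>

definition E_div :: "real \<Rightarrow> 'a measure \<Rightarrow> 'a measure \<Rightarrow> real" where
  "E_div \<gamma> \<mu> \<nu> = (SUP A\<in>sets \<mu>. measure \<mu> A - \<gamma> * measure \<nu> A)"

text \<open>
  The ratios are non-negative, so the embedding into \<open>ennreal\<close> loses nothing; in \<open>ennreal\<close> the supremum
  of the empty set is 0.
\<close>

definition contraction_coeff :: "real \<Rightarrow> 'a measure \<Rightarrow> ('a \<Rightarrow> 'b measure) \<Rightarrow> ennreal" where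
  "contraction_coeff \<gamma> M K =
    Sup {ennreal (E_div \<gamma> (\<mu> \<bind> K) (\<nu> \<bind> K) / E_div \<gamma> \<mu> \<nu>) | \<mu> \<nu>.
           \<mu> \<in> space (prob_algebra M) \<and> \<nu> \<in> space (prob_algebra M) \<and> E_div \<gamma> \<mu> \<nu> \<noteq> 0}"

end

theory Submission
  imports Defs
begin

text \<open>
  With \<open>\<gamma> = exp \<epsilon>\<close>, the layer-cake formula gives \<open>\<integral>g d\<mu> - \<gamma> \<integral>g d\<nu> \<le> E\<^sub>\<gamma>(\<mu>\<parallel>\<nu>)\<close> for measurable \<open>g\<close> with values
  in \<open>[0,1]\<close>. Let \<open>f x = K x A\<close>, with infimum \<open>i\<close> and supremum \<open>s\<close>. Applying this to \<open>(f - i) / (s - i)\<close>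
  bounds \<open>(\<mu>K)(A) - \<gamma> (\<nu>K)(A)\<close> by \<open>i (1 - \<gamma>) + (s - i) E\<^sub>\<gamma>(\<mu>\<parallel>\<nu>)\<close>. Privacy says \<open>s \<le> \<gamma> i + \<delta>\<close>, and
  since \<open>E\<^sub>\<gamma>(\<mu>\<parallel>\<nu>) \<le> 1\<close> the bound is at most \<open>\<delta> E\<^sub>\<gamma>(\<mu>\<parallel>\<nu>)\<close>. The converse tests Dirac measures.
\<close>

section \<open>Elementary bounds on the divergence\<close>

lemma prob_space_mem_prob_algebra: "\<mu> \<in> space (prob_algebra M) \<Longrightarrow> prob_space \<mu>"
  by (simp add: space_prob_algebra)

lemma sets_mem_prob_algebra: "\<mu> \<in> space (prob_algebra M) \<Longrightarrow> sets \<mu> = sets M"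
  by (simp add: space_prob_algebra)

lemma return_mem_prob_algebra: "x \<in> space M \<Longrightarrow> return M x \<in> space (prob_algebra M)"
  by (simp add: space_prob_algebra prob_space_return)

context
  fixes \<gamma> :: real and \<mu> \<nu> :: "'a measure"
  assumes \<gamma>: "\<gamma> \<ge> 0" and \<mu>: "prob_space \<mu>"
begin

text \<open>This bounds the family under the real supremum in \<open>E_div\<close>, so that the
  supremum is a genuine least upper bound.\<close>

lemma E_div_term_le_1: "measure \<mu> A - \<gamma> * measure \<nu> A \<le> 1"
  using \<gamma> prob_space.prob_le_1[OF \<mu>, of A]
  by (smt (verit) measure_nonneg mult_nonneg_nonneg)

lemma E_div_upper: "A \<in> sets \<mu> \<Longrightarrow> measure \<mu> A - \<gamma> * measure \<nu> A \<le> E_div \<gamma> \<mu> \<nu>"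
  unfolding E_div_def
  by (rule cSUP_upper) (auto intro!: bdd_aboveI2[where M=1] E_div_term_le_1)

lemma E_div_nonneg: "0 \<le> E_div \<gamma> \<mu> \<nu>"
  using E_div_upper[of "{}"] by simp

lemma E_div_le_1: "E_div \<gamma> \<mu> \<nu> \<le> 1"
  unfolding E_div_def by (rule cSUP_least) (auto intro: E_div_term_le_1)

end

lemma E_div_least:
  assumes "\<And>A. A \<in> sets \<mu> \<Longrightarrow> measure \<mu> A - \<gamma> * measure \<nu> A \<le> c"
  shows "E_div \<gamma> \<mu> \<nu> \<le> c"
  unfolding E_div_def using assms by (intro cSUP_least) auto

section \<open>Integrals of bounded functions compared with the divergence\<close>

text \<open>The layer-cake formula is replaced by its Riemann sums, which avoids Fubini.\<close>

lemma floor_eq_sum_indicator: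
  fixes r :: real
  assumes "0 \<le> r" "r \<le> real n"
  shows "(\<Sum>k=1..n. if real k \<le> r then 1 else 0) = real_of_int \<lfloor>r\<rfloor>"
proof -
  \<comment> \<open>Since \<open>r\<close> is at most \<open>n\<close>, the cut-off at
    \<open>n\<close> loses none of the indices up to the floor of \<open>r\<close>.\<close>
  have "{k\<in>{1..n}. real k \<le> r} = {1..nat \<lfloor>r\<rfloor>}"
    using assms by (auto simp: le_nat_iff le_floor_iff)
  then have "(\<Sum>k=1..n. if real k \<le> r then 1 else 0) = real (card {1..nat \<lfloor>r\<rfloor>})"
    by (simp add: sum.If_cases Int_def)
  then show ?thesis using assms by simp
qed

text \<open>Up to an error of \<open>1/n\<close>, the left side is the mean over
  \<open>k = 1..n\<close> of the divergence terms of the superlevel sets of \<open>g\<close> at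
  height \<open>k/n\<close>, each at most \<open>E_div \<gamma> \<mu> \<nu>\<close>.\<close>

lemma integral_diff_le_E_div:
  fixes g :: "'a \<Rightarrow> real"
  assumes \<gamma>: "\<gamma> \<ge> 0" and \<mu>: "prob_space \<mu>" and \<nu>: "prob_space \<nu>" and s: "sets \<nu> = sets \<mu>"
    and g: "g \<in> borel_measurable \<mu>" and g01: "\<And>x. x \<in> space \<mu> \<Longrightarrow> 0 \<le> g x \<and> g x \<le> 1"
  shows "(\<integral>x. g x \<partial>\<mu>) - \<gamma> * (\<integral>x. g x \<partial>\<nu>) \<le> E_div \<gamma> \<mu> \<nu>"
proof -
  interpret \<mu>: prob_space \<mu> by fact
  interpret \<nu>: prob_space \<nu> by fact
  have sp: "space \<nu> = space \<mu>" using s by (rule sets_eq_imp_space_eq)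
  have g': "g \<in> borel_measurable \<nu>" using g measurable_cong_sets[OF s refl] by blast
  have ig: "integrable \<mu> g" "integrable \<nu> g"
    using g g' g01 sp by (auto intro!: \<mu>.integrable_const_bound[where B=1] \<nu>.integrable_const_bound[where B=1])
  define d where "d = (\<integral>x. g x \<partial>\<mu>) - \<gamma> * (\<integral>x. g x \<partial>\<nu>)"
  \<comment> \<open>The bound 1 does not depend on \<open>n\<close>, so the Archimedean property
    later excludes a positive difference.\<close>
  have *: "real n * (d - E_div \<gamma> \<mu> \<nu>) \<le> 1" for n :: nat
  proof -
    define B where "B k = {x\<in>space \<mu>. real k \<le> real n * g x}" for k
    have B: "B k \<in> sets \<mu>" "B k \<in> sets \<nu>" for k unfolding B_def using g s by auto
    define S where "S x = (\<Sum>k=1..n. indicator (B k) x :: real)" for x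
    have S: "S x \<le> real n * g x" "real n * g x \<le> 1 + S x" if "x \<in> space \<mu>" for x
    proof -
      have "S x = real_of_int \<lfloor>real n * g x\<rfloor>"
        unfolding S_def
        using that g01[OF that] floor_eq_sum_indicator[of "real n * g x" n]
        by (simp only: B_def indicator_def) (simp add: mult_left_le of_bool_def)
      then show "S x \<le> real n * g x" "real n * g x \<le> 1 + S x" by linarith+
    qed
    have iS: "integrable \<mu> S" "integrable \<nu> S" unfolding S_def using B by (auto simp: less_top[symmetric])
    have "real n * (\<integral>x. g x \<partial>\<mu>) = (\<integral>x. real n * g x \<partial>\<mu>)" by simp
    \<comment> \<open>Rounding costs 1 under \<open>\<mu>\<close> only: the \<open>\<nu>\<close>
      integral enters with a negative sign, and there \<open>S\<close> is already a lower bound for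
      \<open>n * g\<close>.\<close>
    also have "\<dots> \<le> (\<integral>x. 1 + S x \<partial>\<mu>)" using ig iS S by (intro integral_mono) auto
    also have "\<dots> = 1 + (\<integral>x. S x \<partial>\<mu>)" using iS by (simp add: \<mu>.prob_space)
    also have "(\<integral>x. S x \<partial>\<mu>) = (\<Sum>k=1..n. measure \<mu> (B k))"
      unfolding S_def using B by (subst Bochner_Integration.integral_sum) (auto simp: less_top[symmetric])
    finally have 1: "real n * (\<integral>x. g x \<partial>\<mu>) \<le> 1 + (\<Sum>k=1..n. measure \<mu> (B k))" .
    have "(\<Sum>k=1..n. measure \<nu> (B k)) = (\<integral>x. S x \<partial>\<nu>)"
      unfolding S_def using B by (subst Bochner_Integration.integral_sum) (auto simp: less_top[symmetric])
    also have "\<dots> \<le> (\<integral>x. real n * g x \<partial>\<nu>)" using ig iS S sp by (intro integral_mono) auto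
    finally have 2: "(\<Sum>k=1..n. measure \<nu> (B k)) \<le> real n * (\<integral>x. g x \<partial>\<nu>)" by simp
    have "(\<Sum>k=1..n. measure \<mu> (B k) - \<gamma> * measure \<nu> (B k)) \<le> (\<Sum>k=1..n. E_div \<gamma> \<mu> \<nu>)"
      using B by (intro sum_mono E_div_upper \<gamma> \<mu>)
    then have "(\<Sum>k=1..n. measure \<mu> (B k)) - \<gamma> * (\<Sum>k=1..n. measure \<nu> (B k)) \<le> real n * E_div \<gamma> \<mu> \<nu>"
      by (simp add: sum_subtractf sum_distrib_left)
    with 1 mult_left_mono[OF 2 \<gamma>] show ?thesis
      by (simp add: d_def algebra_simps)
  qed
  have "d - E_div \<gamma> \<mu> \<nu> \<le> 0"
  proof (rule ccontr)
    assume "\<not> ?thesis"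
    then obtain n where "1 < real n * (d - E_div \<gamma> \<mu> \<nu>)"
      using reals_Archimedean3[of "d - E_div \<gamma> \<mu> \<nu>"] by auto
    with *[of n] show False by simp
  qed
  then show ?thesis by (simp add: d_def)
qed

text \<open>Rescaling \<open>f\<close> to values in \<open>[0,1]\<close> reduces this to the
  previous bound; as both measures have mass 1, the offset \<open>a\<close> contributes
  \<open>a * (1 - \<gamma>)\<close>.\<close>

lemma integral_diff_le_bounds:
  fixes f :: "'a \<Rightarrow> real"
  assumes \<gamma>: "\<gamma> \<ge> 0" and \<mu>: "prob_space \<mu>" and \<nu>: "prob_space \<nu>" and s: "sets \<nu> = sets \<mu>"
    and f: "f \<in> borel_measurable \<mu>" and fb: "\<And>x. x \<in> space \<mu> \<Longrightarrow> a \<le> f x \<and> f x \<le> b"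
  shows "(\<integral>x. f x \<partial>\<mu>) - \<gamma> * (\<integral>x. f x \<partial>\<nu>) \<le> a * (1 - \<gamma>) + (b - a) * E_div \<gamma> \<mu> \<nu>"
proof -
  interpret \<mu>: prob_space \<mu> by fact
  interpret \<nu>: prob_space \<nu> by fact
  have sp: "space \<nu> = space \<mu>" using s by (rule sets_eq_imp_space_eq)
  have f': "f \<in> borel_measurable \<nu>" using f measurable_cong_sets[OF s refl] by blast
  have bound: "norm (f x) \<le> \<bar>a\<bar> + \<bar>b\<bar>" if "x \<in> space \<mu>" for x using fb[OF that] by auto
  have if': "integrable \<mu> f" "integrable \<nu> f"
    using f f' bound sp by (auto intro!: \<mu>.integrable_const_bound[where B="\<bar>a\<bar> + \<bar>b\<bar>"]
        \<nu>.integrable_const_bound[where B="\<bar>a\<bar> + \<bar>b\<bar>"])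
  have "a \<le> b" using fb \<mu>.not_empty by fastforce
  then consider "a = b" | "a < b" by linarith
  then show ?thesis
  proof cases
    \<comment> \<open>Rescaling would divide by zero here, but \<open>f\<close> is constant and
      equality holds.\<close>
    case 1
    then have "f x = a" if "x \<in> space \<mu>" for x using fb[OF that] by simp
    then have "(\<integral>x. f x \<partial>\<mu>) = (\<integral>x. a \<partial>\<mu>)" "(\<integral>x. f x \<partial>\<nu>) = (\<integral>x. a \<partial>\<nu>)"
      using sp by (intro Bochner_Integration.integral_cong refl; simp)+
    then show ?thesis using 1 by (simp add: \<mu>.prob_space \<nu>.prob_space algebra_simps)
  next
    case 2
    have "(\<integral>x. (f x - a) / (b - a) \<partial>\<mu>) - \<gamma> * (\<integral>x. (f x - a) / (b - a) \<partial>\<nu>) \<le> E_div \<gamma> \<mu> \<nu>"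
      using 2 f fb by (intro integral_diff_le_E_div \<gamma> \<mu> \<nu> s) (auto simp: divide_simps)
    then have "((\<integral>x. f x \<partial>\<mu>) - a - \<gamma> * ((\<integral>x. f x \<partial>\<nu>) - a)) / (b - a) \<le> E_div \<gamma> \<mu> \<nu>"
      using if' by (simp add: \<mu>.prob_space \<nu>.prob_space diff_divide_distrib right_diff_distrib)
    then show ?thesis using 2 by (simp add: pos_divide_le_eq algebra_simps)
  qed
qed

section \<open>Markov kernels and their output distributions\<close>

context
  fixes M :: "'a measure" and N :: "'b measure" and K :: "'a \<Rightarrow> 'b measure"
  assumes K: "K \<in> M \<rightarrow>\<^sub>M prob_algebra N"
begin

lemma sets_markov_kernel: "x \<in> space M \<Longrightarrow> sets (K x) = sets N"
  using measurable_space[OF K] by (rule sets_mem_prob_algebra)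

lemma prob_space_markov_kernel: "x \<in> space M \<Longrightarrow> prob_space (K x)"
  using measurable_space[OF K] by (rule prob_space_mem_prob_algebra)

lemma borel_measurable_markov_kernel: "A \<in> sets N \<Longrightarrow> (\<lambda>x. measure (K x) A) \<in> borel_measurable M"
  using measurable_compose[OF K measurable_measure_prob_algebra] .

lemma bind_mem_prob_algebra:
  assumes "\<mu> \<in> space (prob_algebra M)"
  shows "\<mu> \<bind> K \<in> space (prob_algebra N)"
  using measurable_space[OF measurable_bind_prob_space[OF measurable_ident K] assms] by simp

lemma bind_return_markov_kernel: "x \<in> space M \<Longrightarrow> return M x \<bind> K = K x"
  using measurable_prob_algebraD[OF K] by (rule bind_return)

text \<open>Extended-real suprema form a complete lattice, so they unfold to pointwise bounds even
  over an empty input space.\<close>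

lemma LDP_iff:
  "LDP \<epsilon> \<delta> M N K \<longleftrightarrow>
     (\<forall>x1\<in>space M. \<forall>x2\<in>space M. \<forall>A\<in>sets N. measure (K x1) A - exp \<epsilon> * measure (K x2) A \<le> \<delta>)"
  unfolding LDP_def by (simp add: SUP_le_iff)

lemma measure_bind_markov_kernel:
  assumes "\<mu> \<in> space (prob_algebra M)" "A \<in> sets N"
  shows "measure (\<mu> \<bind> K) A = (\<integral>x. measure (K x) A \<partial>\<mu>)"
proof -
  interpret prob_space \<mu> using assms(1) by (rule prob_space_mem_prob_algebra)
  have "K \<in> \<mu> \<rightarrow>\<^sub>M subprob_algebra N"
    using measurable_prob_algebraD[OF K] measurable_cong_sets[OF sets_mem_prob_algebra[OF assms(1)] refl]
    by blast
  then show ?thesis using assms(2) by (rule measure_bind)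
qed

section \<open>From privacy to contraction\<close>

lemma LDP_imp_E_div_bind_le:
  assumes LDP: "LDP \<epsilon> \<delta> M N K" and "\<epsilon> \<ge> 0"
    and \<mu>: "\<mu> \<in> space (prob_algebra M)" and \<nu>: "\<nu> \<in> space (prob_algebra M)"
  shows "E_div (exp \<epsilon>) (\<mu> \<bind> K) (\<nu> \<bind> K) \<le> \<delta> * E_div (exp \<epsilon>) \<mu> \<nu>"
proof (rule E_div_least)
  fix A assume "A \<in> sets (\<mu> \<bind> K)"
  then have A: "A \<in> sets N" using sets_mem_prob_algebra[OF bind_mem_prob_algebra[OF \<mu>]] by simp
  define f where "f x = measure (K x) A" for x
  define \<gamma> where "\<gamma> = exp \<epsilon>"
  define E where "E = E_div \<gamma> \<mu> \<nu>"
  have \<gamma>: "\<gamma> \<ge> 1" using \<open>\<epsilon> \<ge> 0\<close> by (simp add: \<gamma>_def)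
  have p\<mu>: "prob_space \<mu>" and p\<nu>: "prob_space \<nu>"
    using \<mu> \<nu> by (auto intro: prob_space_mem_prob_algebra)
  have sp: "space \<mu> = space M" using sets_eq_imp_space_eq[OF sets_mem_prob_algebra[OF \<mu>]] .
  have E: "0 \<le> E" "E \<le> 1" unfolding E_def using \<gamma> p\<mu> by (auto intro!: E_div_nonneg E_div_le_1)
  \<comment> \<open>A probability measure on the input space forces it to be nonempty, which the
    real \<open>INF\<close> and \<open>SUP\<close> below rely on.\<close>
  have ne: "space M \<noteq> {}" using prob_space.not_empty[OF p\<mu>] sp by simp
  have f01: "0 \<le> f x" "f x \<le> 1" if "x \<in> space M" for x
    using prob_space.prob_le_1[OF prob_space_markov_kernel[OF that]] by (auto simp: f_def)
  define i where "i = (INF x\<in>space M. f x)"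
  define s where "s = (SUP x\<in>space M. f x)"
  have f_bounds: "i \<le> f x" "f x \<le> s" if "x \<in> space M" for x
    using that f01 unfolding i_def s_def
    by (auto intro!: cINF_lower cSUP_upper bdd_belowI2[where m=0] bdd_aboveI2[where M=1])
  have i0: "0 \<le> i" unfolding i_def using ne f01 by (intro cINF_greatest) auto
  \<comment> \<open>Privacy for the event \<open>A\<close>; taking the supremum over
    \<open>x\<close>, then the infimum over \<open>y\<close>, yields
    \<open>s \<le> \<gamma> * i + \<delta>\<close>.\<close>
  have "f x \<le> \<gamma> * f y + \<delta>" if "x \<in> space M" "y \<in> space M" for x y
    using LDP[unfolded LDP_iff] that A by (fastforce simp: f_def \<gamma>_def)
  then have "s \<le> \<gamma> * f y + \<delta>" if "y \<in> space M" for y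
    unfolding s_def using ne that by (intro cSUP_least) auto
  then have "(s - \<delta>) / \<gamma> \<le> f y" if "y \<in> space M" for y
    using \<gamma> that by (simp add: pos_divide_le_eq) (smt (verit) mult.commute)
  then have "(s - \<delta>) / \<gamma> \<le> i"
    unfolding i_def using ne by (intro cINF_greatest) auto
  then have si: "s - i - \<delta> \<le> (\<gamma> - 1) * i" using \<gamma> by (simp add: pos_divide_le_eq algebra_simps)
  have "measure (\<mu> \<bind> K) A - \<gamma> * measure (\<nu> \<bind> K) A = (\<integral>x. f x \<partial>\<mu>) - \<gamma> * (\<integral>x. f x \<partial>\<nu>)"
    using \<mu> \<nu> A by (simp add: measure_bind_markov_kernel f_def)
  also have "\<dots> \<le> i * (1 - \<gamma>) + (s - i) * E"
    unfolding E_def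
  proof (rule integral_diff_le_bounds[OF _ p\<mu> p\<nu>])
    show "f \<in> borel_measurable \<mu>"
      using borel_measurable_markov_kernel[OF A] measurable_cong_sets[OF sets_mem_prob_algebra[OF \<mu>] refl]
      unfolding f_def by blast
  qed (use \<gamma> f_bounds sp sets_mem_prob_algebra[OF \<mu>] sets_mem_prob_algebra[OF \<nu>] in auto)
  also have "\<dots> \<le> \<delta> * E"
  proof -
    \<comment> \<open>The excess of \<open>s - i\<close> over \<open>\<delta>\<close> is absorbed by
      the negative term \<open>i * (1 - \<gamma>)\<close>; as \<open>(\<gamma> - 1) * i\<close> is
      nonnegative, \<open>E \<le> 1\<close> lets the factor \<open>E\<close> be dropped.\<close>
    have "E * (s - i - \<delta>) \<le> E * ((\<gamma> - 1) * i)" using si E by (intro mult_left_mono) auto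
    also have "\<dots> \<le> 1 * ((\<gamma> - 1) * i)" using E \<gamma> i0 by (intro mult_right_mono) auto
    finally show ?thesis by (simp add: algebra_simps)
  qed
  finally show "measure (\<mu> \<bind> K) A - exp \<epsilon> * measure (\<nu> \<bind> K) A \<le> \<delta> * E_div (exp \<epsilon>) \<mu> \<nu>"
    by (simp add: E_def \<gamma>_def)
qed

section \<open>From contraction to privacy\<close>

text \<open>Divergence 0 between Dirac measures does not mean equal points, only that no measurable set separates them.\<close>

lemma E_div_return_eq_0_imp_kernel_eq:
  assumes x: "x1 \<in> space M" "x2 \<in> space M" and A: "A \<in> sets N" and \<gamma>: "\<gamma> \<ge> 0"
    and E: "E_div \<gamma> (return M x1) (return M x2) = 0"
  shows "measure (K x1) A = measure (K x2) A"
proof -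
  \<comment> \<open>The level set through \<open>x1\<close> is measurable; if it missed
    \<open>x2\<close>, its divergence term would be 1.\<close>
  define B where "B = {x\<in>space M. measure (K x) A = measure (K x1) A}"
  have B: "B \<in> sets M" unfolding B_def using borel_measurable_markov_kernel[OF A] by measurable
  have "measure (return M x1) B - \<gamma> * measure (return M x2) B \<le> 0"
    using E_div_upper[OF \<gamma> prob_space_return[OF x(1)], of B "return M x2"] B E by simp
  moreover have "x1 \<in> B" using x(1) by (simp add: B_def)
  ultimately have "x2 \<in> B" using B by (cases "x2 \<in> B") (simp_all add: measure_return)
  then show ?thesis by (simp add: B_def)
qed

text \<open>Dirac inputs at \<open>x1\<close> and \<open>x2\<close> have outputs \<open>K x1\<close>
  and \<open>K x2\<close> and divergence at most 1. Contraction is assumed only at nonzero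
  divergence, which is all that the coefficient controls.\<close>

lemma LDP_of_contraction:
  assumes "\<epsilon> \<ge> 0" "\<delta> \<ge> 0"
    and contr: "\<And>\<mu> \<nu>. \<lbrakk>\<mu> \<in> space (prob_algebra M); \<nu> \<in> space (prob_algebra M); E_div (exp \<epsilon>) \<mu> \<nu> \<noteq> 0\<rbrakk>
        \<Longrightarrow> E_div (exp \<epsilon>) (\<mu> \<bind> K) (\<nu> \<bind> K) \<le> \<delta> * E_div (exp \<epsilon>) \<mu> \<nu>"
  shows "LDP \<epsilon> \<delta> M N K"
  unfolding LDP_iff
proof (intro ballI)
  fix x1 x2 A assume x: "x1 \<in> space M" "x2 \<in> space M" and A: "A \<in> sets N"
  let ?E = "E_div (exp \<epsilon>) (return M x1) (return M x2)"
  show "measure (K x1) A - exp \<epsilon> * measure (K x2) A \<le> \<delta>"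
  proof (cases "?E = 0")
    \<comment> \<open>The contraction hypothesis is silent here, but both points give
      \<open>A\<close> the same probability, so the difference is at most 0.\<close>
    case True
    have "1 * measure (K x2) A \<le> exp \<epsilon> * measure (K x2) A"
      using \<open>\<epsilon> \<ge> 0\<close> by (intro mult_right_mono) auto
    then show ?thesis
      using E_div_return_eq_0_imp_kernel_eq[OF x A _ True] \<open>\<delta> \<ge> 0\<close> by simp
  next
    case False
    have "measure (K x1) A - exp \<epsilon> * measure (K x2) A \<le> E_div (exp \<epsilon>) (K x1) (K x2)"
      using x A by (intro E_div_upper prob_space_markov_kernel) (auto simp: sets_markov_kernel)
    also have "\<dots> \<le> \<delta> * ?E"
      using contr[OF return_mem_prob_algebra return_mem_prob_algebra False] x
      by (simp add: bind_return_markov_kernel)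
    also have "\<dots> \<le> \<delta>"
      using \<open>\<delta> \<ge> 0\<close> x by (intro mult_left_le E_div_le_1 prob_space_return) auto
    finally show ?thesis .
  qed
qed

text \<open>A nonzero divergence is positive, so the denominator can be cleared; with
  \<open>\<delta> \<ge> 0\<close> the embedding into \<open>ennreal\<close> preserves the
  comparison.\<close>

lemma contraction_coeff_le_iff:
  assumes "\<gamma> \<ge> 0" "\<delta> \<ge> 0"
  shows "contraction_coeff \<gamma> M K \<le> ennreal \<delta> \<longleftrightarrow>
    (\<forall>\<mu>\<in>space (prob_algebra M). \<forall>\<nu>\<in>space (prob_algebra M). E_div \<gamma> \<mu> \<nu> \<noteq> 0 \<longrightarrow>
       E_div \<gamma> (\<mu> \<bind> K) (\<nu> \<bind> K) \<le> \<delta> * E_div \<gamma> \<mu> \<nu>)"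
proof -
  have "ennreal (E_div \<gamma> (\<mu> \<bind> K) (\<nu> \<bind> K) / E_div \<gamma> \<mu> \<nu>) \<le> ennreal \<delta> \<longleftrightarrow>
      E_div \<gamma> (\<mu> \<bind> K) (\<nu> \<bind> K) \<le> \<delta> * E_div \<gamma> \<mu> \<nu>"
    if "\<mu> \<in> space (prob_algebra M)" "E_div \<gamma> \<mu> \<nu> \<noteq> 0" for \<mu> \<nu>
  proof -
    have "E_div \<gamma> \<mu> \<nu> > 0"
      using E_div_nonneg[OF \<open>\<gamma> \<ge> 0\<close> prob_space_mem_prob_algebra[OF that(1)], of \<nu>] that(2) by simp
    then show ?thesis using \<open>\<delta> \<ge> 0\<close> by (simp add: pos_divide_le_eq)
  qed
  then show ?thesis unfolding contraction_coeff_def Sup_le_iff by blast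
qed

end

theorem theorem3:
  fixes \<epsilon> \<delta> :: real
    and D :: "'a::euclidean_space set" and W :: "'b::euclidean_space set"
    and K :: "'a \<Rightarrow> 'b measure"
  assumes "\<epsilon> \<ge> 0" and "0 \<le> \<delta>" and "\<delta> \<le> 1"
    and "K \<in> restrict_space borel D \<rightarrow>\<^sub>M prob_algebra (restrict_space borel W)"
  shows "(LDP \<epsilon> \<delta> (restrict_space borel D) (restrict_space borel W) K \<longleftrightarrow>
            contraction_coeff (exp \<epsilon>) (restrict_space borel D) K \<le> ennreal \<delta>) \<and>
         (LDP \<epsilon> \<delta> (restrict_space borel D) (restrict_space borel W) K \<longleftrightarrow>
            (\<forall>\<mu>\<in>space (prob_algebra (restrict_space borel D)).
             \<forall>\<nu>\<in>space (prob_algebra (restrict_space borel D)).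
               E_div (exp \<epsilon>) (\<mu> \<bind> K) (\<nu> \<bind> K) \<le> \<delta> * E_div (exp \<epsilon>) \<mu> \<nu>))"
proof -
  let ?M = "restrict_space borel D" and ?N = "restrict_space borel W"
  note K = assms(4)
  have all: "\<forall>\<mu>\<in>space (prob_algebra ?M). \<forall>\<nu>\<in>space (prob_algebra ?M).
      E_div (exp \<epsilon>) (\<mu> \<bind> K) (\<nu> \<bind> K) \<le> \<delta> * E_div (exp \<epsilon>) \<mu> \<nu>" if "LDP \<epsilon> \<delta> ?M ?N K"
    using LDP_imp_E_div_bind_le[OF K that assms(1)] by blast
  have coeff: "contraction_coeff (exp \<epsilon>) ?M K \<le> ennreal \<delta> \<longleftrightarrow>
    (\<forall>\<mu>\<in>space (prob_algebra ?M). \<forall>\<nu>\<in>space (prob_algebra ?M). E_div (exp \<epsilon>) \<mu> \<nu> \<noteq> 0 \<longrightarrow>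
       E_div (exp \<epsilon>) (\<mu> \<bind> K) (\<nu> \<bind> K) \<le> \<delta> * E_div (exp \<epsilon>) \<mu> \<nu>)"
    using contraction_coeff_le_iff[OF K, of "exp \<epsilon>" \<delta>] assms(2) by simp
  \<comment> \<open>A cycle closes both equivalences: privacy gives the inequality for all pairs,
    this restricts to nonzero divergence, and that gives privacy back. Pairs of zero divergence are
    thus reached from the coefficient only through privacy.\<close>
  show ?thesis
    unfolding coeff using all LDP_of_contraction[OF K assms(1,2)] by blast
qed

end
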